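(* Let $L$ be the combinatorial model of the real line and let $f:L\rightarrow L$ be a continuous map that has a periodic point of period $2$. Then $f$ satisfies exactly one of the following properties. \begin{itemize} \item $f$ is a homeomorphism that fixes only one point $z$, and every $s\in L\setminus\{z\}$ is a periodic point of period $2$. \item $f$ fixes only one point $z$, and there exists an interval $[x,y]$ (with $x,y\in L$) containing $z$ such that every $t\in[x,y]\setminus\{z\}$ is a periodic point of period $2$ and for every $t\in L\setminus[x,y]$ there exists a positive integer $n$ with $f^n(t)\in[x,y]$. \end{itemize}
   Context: $L=\{x_i\}_{i\in\mathbb{Z}}$ (the $x_i$ pairwise distinct) is the poset, called the combinatorial model of the real line, whose only strict relations are $x_i<x_{i+1}>x_{i+2}$ for every odd $i\in\mathbb{Z}$; thus points of odd index are minimal, points of even index are maximal, and each even-indexed $x_i$ lies above exactly $x_{i-1}$ and $x_{i+1}$. $L$ is regarded as an Alexandroff $T_0$-space, the smallest open set containing $x$ being $U_x=\{y\in L: y\leq x\}$; a map $f:L\to L$ is continuous if and only if it is order-preserving ($x\leq y$ implies $f(x)\leq f(y)$). A point $x$ is a periodic point of period $n$ of $f$ if $n$ is the smallest positive integer with $f^n(x)=x$. For $a=x_i$ and $b=x_j$ in $L$, the interval $[a,b]=[b,a]$ is the set of points in the fence joining $a$ and $b$, i.e. $[a,b]=\{x_k:\min(i,j)\leq k\leq\max(i,j)\}$. *)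

theory Defs
  imports "HOL-Analysis.Analysis"
begin

text \<open>The combinatorial model of the real line: the point \<open>X i\<close> stands for $x_i$.\<close>

datatype L = X (idx: int)

instantiation L :: order
begin

definition less_L :: "L \<Rightarrow> L \<Rightarrow> bool" where
  "a < (b::L) \<longleftrightarrow> (\<exists>i. odd i \<and> b = X (i + 1) \<and> (a = X i \<or> a = X (i + 2)))"

definition less_eq_L :: "L \<Rightarrow> L \<Rightarrow> bool" where
  "a \<le> b \<longleftrightarrow> a = b \<or> a < (b::L)"

instance
  by standard (auto simp: less_eq_L_def less_L_def)

end

instantiation L :: topological_space
begin

text \<open>The Alexandroff topology: the open sets are the down-sets.\<close>

definition open_L :: "L set \<Rightarrow> bool" where
  "open (S :: L set) \<longleftrightarrow> (\<forall>x\<in>S. {..x} \<subseteq> S)"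

instance
  by standard (auto simp: open_L_def)

end

lemma open_atMost_L: "open {..x::L}"
  by (auto simp: open_L_def)

lemma atMost_least_open_L: "open S \<Longrightarrow> x \<in> S \<Longrightarrow> {..x::L} \<subseteq> S"
  by (simp add: open_L_def)

instance L :: t0_space
proof
  fix x y :: L
  assume "x \<noteq> y"
  then have "\<not> x \<le> y \<or> \<not> y \<le> x"
    by auto
  then show "\<exists>U. open U \<and> \<not> (x \<in> U \<longleftrightarrow> y \<in> U)"
    using open_atMost_L[of x] open_atMost_L[of y] by (metis atMost_iff order_refl)
qed

lemma continuous_iff_mono_L:
  fixes f :: "L \<Rightarrow> L"
  shows "continuous_on UNIV f \<longleftrightarrow> mono f"
proof
  assume c: "continuous_on UNIV f"
  show "mono f"
  proof
    fix x y :: L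
    assume "x \<le> y"
    have "open (f -` {..f y})"
      using c open_atMost_L by (simp add: continuous_on_open_vimage)
    then have "{..y} \<subseteq> f -` {..f y}"
      by (rule atMost_least_open_L) simp
    with \<open>x \<le> y\<close> show "f x \<le> f y"
      by auto
  qed
next
  assume "mono f"
  then show "continuous_on UNIV f"
    by (auto simp: continuous_on_open_vimage open_L_def subset_iff dest: monoD)
qed

text \<open>The interval refers to the linear order of the indices and is thus different
  from \<open>{a..b}\<close>, which refers to the partial order of \<open>L\<close>.\<close>

definition fence_interval :: "L \<Rightarrow> L \<Rightarrow> L set" where
  "fence_interval a b = X ` {min (idx a) (idx b)..max (idx a) (idx b)}"

definition has_period :: "('a \<Rightarrow> 'a) \<Rightarrow> 'a \<Rightarrow> nat \<Rightarrow> bool" where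
  "has_period f x n \<longleftrightarrow>
     n > 0 \<and> (f ^^ n) x = x \<and> (\<forall>m. 0 < m \<and> m < n \<longrightarrow> (f ^^ m) x \<noteq> x)"

definition fixes_only :: "('a \<Rightarrow> 'a) \<Rightarrow> 'a \<Rightarrow> bool" where
  "fixes_only f z \<longleftrightarrow> (\<forall>w. f w = w \<longleftrightarrow> w = z)"

text \<open>The two alternatives.\<close>

definition period_two_homeomorphism :: "(L \<Rightarrow> L) \<Rightarrow> bool" where
  "period_two_homeomorphism f \<longleftrightarrow>
     (\<exists>g. homeomorphism UNIV UNIV f g) \<and>
     (\<exists>z. fixes_only f z \<and> (\<forall>s\<in>UNIV - {z}. has_period f s 2))"

definition absorbed_by_period_two_interval :: "(L \<Rightarrow> L) \<Rightarrow> bool" where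
  "absorbed_by_period_two_interval f \<longleftrightarrow>
     (\<exists>z. fixes_only f z \<and>
       (\<exists>x y. z \<in> fence_interval x y \<and>
         (\<forall>t\<in>fence_interval x y - {z}. has_period f t 2) \<and>
         (\<forall>t\<in>UNIV - fence_interval x y. \<exists>n>0. (f ^^ n) t \<in> fence_interval x y)))"

end

theory Submission
  imports Defs
begin

text \<open>
  A monotone self-map of the fence, read on indices, changes by at most one from an index to the
  next, so it is non-expansive; and where it does change, it preserves the parity of the index.

  Let \<open>a < b\<close> be the indices of a two-cycle. The endpoints of the segment between them are mapped
  to points at the full distance \<open>b - a\<close>, so non-expansiveness leaves no freedom in between: the
  map is the reflection \<open>i \<mapsto> a + b - i\<close> there. Since it moves away from \<open>a\<close>, the parity rule makes
  \<open>b - a\<close> even, and the midpoint \<open>z\<close> is fixed. No other point is fixed, because a fixed point on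
  one side of \<open>z\<close> would be carried too far from the image of the neighbour of \<open>z\<close> on that side.

  Measure indices from \<open>z\<close>, and let \<open>m\<close> be the largest radius on which the map is the reflection
  \<open>k \<mapsto> - k\<close>. If there is none, the map is the reflection everywhere and is an involutive
  homeomorphism. Otherwise the reflection breaks down on at least one side at distance \<open>m + 1\<close>.
  On that side the map strictly decreases every distance to \<open>z\<close> larger than \<open>m\<close>, whereas on the
  opposite side the distance either decreases or is kept by a jump to the side where it decreases
  next. Hence two steps from outside radius \<open>m\<close> decrease the distance
  (\<open>broken_reflection_contracts\<close>), and every orbit enters radius \<open>m\<close>.

  The two alternatives exclude each other because, under an involution, an orbit that starts
  outside a finite interval and enters it must do so at its first step. The infinite complement of
  the interval would then be mapped injectively into the interval.
\<close>

section \<open>Monotone maps of the fence on indices\<close>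

text \<open>The parity clause records the direction of the order: comparable distinct points of the
  fence keep their roles as minimal and maximal point unless they are identified.\<close>

lemma mono_fence_step:
  assumes "mono f"
  shows "idx (f (X (i + 1))) = idx (f (X i)) \<or>
    \<bar>idx (f (X (i + 1))) - idx (f (X i))\<bar> = 1 \<and> even (idx (f (X i)) - i)"
proof (cases "odd i")
  case True
  then have "X i \<le> X (i + 1)"
    by (auto simp: less_eq_L_def less_L_def)
  then have "f (X i) \<le> f (X (i + 1))"
    using assms by (rule monoD[rotated])
  then show ?thesis
    using True by (auto simp: less_eq_L_def less_L_def)
next
  case False
  then have "X (i + 1) \<le> X i"
    by (auto simp: less_eq_L_def less_L_def intro!: exI[of _ "i - 1"])
  then have "f (X (i + 1)) \<le> f (X i)"
    using assms by (rule monoD[rotated])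
  then show ?thesis
    using False by (auto simp: less_eq_L_def less_L_def)
qed

definition nonexpansive :: "(int \<Rightarrow> int) \<Rightarrow> bool" where
  "nonexpansive G \<longleftrightarrow> (\<forall>i j. \<bar>G i - G j\<bar> \<le> \<bar>i - j\<bar>)"

lemma nonexpansiveD: "nonexpansive G \<Longrightarrow> \<bar>G i - G j\<bar> \<le> \<bar>i - j\<bar>"
  by (simp add: nonexpansive_def)

lemma nonexpansiveI_step:
  fixes G :: "int \<Rightarrow> int"
  assumes step: "\<And>i. \<bar>G (i + 1) - G i\<bar> \<le> 1"
  shows "nonexpansive G"
proof -
  have up: "\<bar>G (i + int n) - G i\<bar> \<le> int n" for i n
  proof (induction n)
    case (Suc n)
    then show ?case
      using step[of "i + int n"] by (simp add: algebra_simps)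
  qed simp
  have "\<bar>G i - G j\<bar> \<le> \<bar>i - j\<bar>" for i j
    using up[of i "nat (j - i)"] up[of j "nat (i - j)"] by (cases "i \<le> j") auto
  then show ?thesis
    by (simp add: nonexpansive_def)
qed

lemma nonexpansive_idx:
  assumes "mono f"
  shows "nonexpansive (\<lambda>i. idx (f (X i)))"
proof (rule nonexpansiveI_step)
  fix i
  show "\<bar>idx (f (X (i + 1))) - idx (f (X i))\<bar> \<le> 1"
    using mono_fence_step[OF assms, of i] by linarith
qed

section \<open>Non-expansive integer maps near a two-cycle\<close>

lemma nonexpansive_two_cycle_reflects:
  assumes "nonexpansive F" and "F a = b" and "F b = a" and "a \<le> i" and "i \<le> b"
  shows "F i = a + b - i"
  using nonexpansiveD[OF assms(1), of i a] nonexpansiveD[OF assms(1), of i b] assms by linarith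

text \<open>If the reflection stops on the positive side, then beyond radius \<open>m\<close> that side moves strictly
  towards the centre. The negative side never moves outwards, and keeps its distance only by landing
  on the positive side; this is why two steps are considered.\<close>

lemma broken_reflection_contracts_pos:
  assumes G: "nonexpansive G" and "m \<ge> 1" and "G m = - m" and "G (- m) = m"
    and broken: "G (m + 1) \<noteq> - (m + 1)" and t: "\<bar>t\<bar> > m"
  shows "\<bar>G (G t)\<bar> < \<bar>t\<bar>"
proof -
  have pos: "\<bar>G k\<bar> < k" if "k > m" for k
    using nonexpansiveD[OF G, of k "m + 1"] nonexpansiveD[OF G, of k m]
      nonexpansiveD[OF G, of "m + 1" m] assms that by linarith
  have neg: "- k < G (- k) \<and> G (- k) \<le> k" if "k > m" for k
    using nonexpansiveD[OF G, of "- k" "- m"] assms that by linarith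
  have "G 0 = 0"
    using nonexpansive_two_cycle_reflects[OF G \<open>G (- m) = m\<close> \<open>G m = - m\<close>, of 0] \<open>m \<ge> 1\<close> by simp
  then have bound: "\<bar>G k\<bar> \<le> \<bar>k\<bar>" for k
    using nonexpansiveD[OF G, of k 0] by simp
  show ?thesis
  proof (cases "\<bar>G t\<bar> < \<bar>t\<bar>")
    case True
    then show ?thesis
      using bound[of "G t"] by linarith
  next
    case False
    then have "G t = \<bar>t\<bar>"
      using pos[of t] neg[of "- t"] t by (cases "t > 0") auto
    then show ?thesis
      using pos[of "\<bar>t\<bar>"] t by simp
  qed
qed

lemma broken_reflection_contracts:
  assumes G: "nonexpansive G" and m: "m \<ge> 1" "G m = - m" "G (- m) = m"
    and broken: "\<not> (G (m + 1) = - (m + 1) \<and> G (- (m + 1)) = m + 1)" and t: "\<bar>t\<bar> > m"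
  shows "\<bar>G (G t)\<bar> < \<bar>t\<bar>"
proof (cases "G (m + 1) = - (m + 1)")
  case False
  then show ?thesis
    using broken_reflection_contracts_pos[OF G m _ t] by simp
next
  \<comment> \<open>Conjugating by \<open>k \<mapsto> - k\<close> brings the break to the positive side.\<close>
  case True
  define H where "H k = - G (- k)" for k
  have "\<bar>H i - H j\<bar> \<le> \<bar>i - j\<bar>" for i j
    using nonexpansiveD[OF G, of "- i" "- j"] by (simp add: H_def)
  then have "nonexpansive H"
    by (simp add: nonexpansive_def)
  then have "\<bar>H (H (- t))\<bar> < \<bar>- t\<bar>"
    by (rule broken_reflection_contracts_pos) (use m t broken True in \<open>auto simp: H_def\<close>)
  then show ?thesis
    by (simp add: H_def)
qed

lemma contracting_orbit_enters:
  fixes G :: "int \<Rightarrow> int"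
  assumes contr: "\<And>t. \<bar>t\<bar> > m \<Longrightarrow> \<bar>G (G t)\<bar> < \<bar>t\<bar>"
  shows "\<exists>n>0. \<bar>t\<bar> > m \<longrightarrow> \<bar>(G ^^ n) t\<bar> \<le> m"
proof (induction "nat \<bar>t\<bar>" arbitrary: t rule: less_induct)
  case less
  show ?case
  proof (cases "\<bar>t\<bar> > m \<and> \<bar>G (G t)\<bar> > m")
    case True
    then have "nat \<bar>G (G t)\<bar> < nat \<bar>t\<bar>"
      using contr[of t] by linarith
    with less True obtain n where "\<bar>(G ^^ n) (G (G t))\<bar> \<le> m"
      by blast
    then have "\<bar>(G ^^ (n + 2)) t\<bar> \<le> m"
      by (simp only: funpow_add o_apply) (simp add: numeral_2_eq_2)
    then show ?thesis
      by (intro exI[of _ "n + 2"]) simp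
  next
    case False
    then show ?thesis
      by (intro exI[of _ 2]) (auto simp: numeral_2_eq_2)
  qed
qed

section \<open>Points of period two\<close>

lemma has_period_2_iff: "has_period f x 2 \<longleftrightarrow> f (f x) = x \<and> f x \<noteq> x"
proof -
  have "0 < m \<and> m < 2 \<longleftrightarrow> m = 1" for m :: nat
    by auto
  then show ?thesis
    by (simp add: has_period_def numeral_2_eq_2)
qed

lemma funpow_involution:
  assumes "\<And>x. f (f x) = x"
  shows "(f ^^ n) x = x \<or> (f ^^ n) x = f x"
  by (induction n) (use assms in auto)

lemma infinite_UNIV_L: "infinite (UNIV :: L set)"
proof
  assume "finite (UNIV :: L set)"
  moreover have "inj X"
    by (rule injI) simp
  ultimately show False
    using finite_imageD[of X UNIV] finite_subset[of "range X" UNIV] infinite_UNIV_int by blast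
qed

lemma alternatives_exclusive:
  "\<not> (period_two_homeomorphism f \<and> absorbed_by_period_two_interval f)"
proof
  assume "period_two_homeomorphism f \<and> absorbed_by_period_two_interval f"
  then obtain z x y where z: "fixes_only f z" and per: "\<forall>s\<in>UNIV - {z}. has_period f s 2"
    and absorb: "\<forall>t\<in>UNIV - fence_interval x y. \<exists>n>0. (f ^^ n) t \<in> fence_interval x y"
    unfolding period_two_homeomorphism_def absorbed_by_period_two_interval_def by blast
  let ?I = "fence_interval x y"
  have invol: "f (f s) = s" for s
  proof (cases "s = z")
    case True
    have "f z = z"
      using z by (simp add: fixes_only_def)
    with True show ?thesis
      by simp
  next
    case False
    with per show ?thesis
      by (simp add: has_period_2_iff)
  qed
  then have "inj f"
    by (metis injI)
  have "f ` (- ?I) \<subseteq> ?I"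
  proof
    fix s
    assume "s \<in> f ` (- ?I)"
    then obtain t where "t \<notin> ?I" and "s = f t"
      by auto
    with absorb funpow_involution[of f _ t, OF invol] show "s \<in> ?I"
      by (metis DiffI UNIV_I)
  qed
  moreover have fin: "finite ?I"
    by (simp add: fence_interval_def)
  ultimately have "finite (- ?I)"
    using \<open>inj f\<close> by (metis finite_subset finite_imageD inj_on_subset subset_UNIV)
  with fin show False
    using infinite_UNIV_L by (simp add: finite_compl)
qed

section \<open>The dichotomy\<close>

theorem theorem3p5:
  fixes f :: "L \<Rightarrow> L"
  assumes "continuous_on UNIV f"
    and "\<exists>p. has_period f p 2"
  shows "(period_two_homeomorphism f \<or> absorbed_by_period_two_interval f) \<and>
    \<not> (period_two_homeomorphism f \<and> absorbed_by_period_two_interval f)"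
proof -
  have mono: "mono f"
    using assms(1) by (simp add: continuous_iff_mono_L)
  define F where "F i = idx (f (X i))" for i
  have fX: "f (X i) = X (F i)" for i
    by (simp add: F_def)
  have F: "nonexpansive F"
    unfolding F_def by (rule nonexpansive_idx[OF mono])
  from assms(2) obtain p where p: "f (f p) = p" "f p \<noteq> p"
    by (auto simp: has_period_2_iff)
  obtain a b where ab: "a < b" "F a = b" "F b = a"
  proof -
    define c where "c = idx p"
    have "F (F c) = c" "F c \<noteq> c"
      using p by (cases p; simp add: c_def fX)+
    then show ?thesis
      using that[of c "F c"] that[of "F c" c] by linarith
  qed
  note refl = nonexpansive_two_cycle_reflects[OF F ab(2,3)]
  \<comment> \<open>The images \<open>b\<close> of \<open>a\<close> and \<open>b - 1\<close> of \<open>a + 1\<close> differ, so the parity rule applies at \<open>a\<close>.\<close>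
  have "even (b - a)"
    using mono_fence_step[OF mono, of a] refl[of "a + 1"] ab by (auto simp: F_def)
  then obtain d where "b - a = 2 * d" ..
  then have d: "b = a + 2 * d"
    by simp
  define z where "z = a + d"
  define G where "G k = F (z + k) - z" for k
  have fG: "f (X (z + k)) = X (z + G k)" for k
    by (simp add: fX G_def)
  have fGn: "(f ^^ n) (X (z + k)) = X (z + (G ^^ n) k)" for n k
    by (induction n) (auto simp: fG)
  have coord: "\<exists>k. s = X (z + k)" for s
    by (cases s) (auto intro: exI[of _ "idx s - z"])
  have G: "nonexpansive G"
    unfolding nonexpansive_def G_def
  proof (intro allI)
    fix i j
    show "\<bar>F (z + i) - z - (F (z + j) - z)\<bar> \<le> \<bar>i - j\<bar>"
      using nonexpansiveD[OF F, of "z + i" "z + j"] by simp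
  qed
  have G_refl: "G k = - k" if "\<bar>k\<bar> \<le> d" for k
    using refl[of "z + k"] that d by (simp add: G_def z_def)
  have "d \<ge> 1"
    using ab d by simp
  have G1: "G 0 = 0" "G 1 = - 1" "G (- 1) = 1"
    using G_refl \<open>d \<ge> 1\<close> by auto
  have G_fix: "G k = k \<longleftrightarrow> k = 0" for k
    using nonexpansiveD[OF G, of k 1] nonexpansiveD[OF G, of k "- 1"] G1 by auto
  have fix_z: "fixes_only f (X z)"
    unfolding fixes_only_def
  proof
    fix w
    obtain k where "w = X (z + k)"
      using coord by blast
    then show "f w = w \<longleftrightarrow> w = X z"
      by (simp add: fG G_fix)
  qed
  have "period_two_homeomorphism f \<or> absorbed_by_period_two_interval f"
  proof (cases "\<forall>k. G k = - k")
    case True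
    have invol: "f (f s) = s" for s
    proof -
      obtain k where "s = X (z + k)"
        using coord by blast
      then show ?thesis
        using True fG[of k] fG[of "- k"] by simp
    qed
    then have "homeomorphism UNIV UNIV f f"
      using assms(1) by (intro homeomorphismI) auto
    then have "period_two_homeomorphism f"
      unfolding period_two_homeomorphism_def
      using fix_z invol by (auto simp: has_period_2_iff fixes_only_def)
    then show ?thesis ..
  next
    case False
    define R where "R n \<longleftrightarrow> G (int n) = - int n \<and> G (- int n) = int n" for n
    have "\<exists>n. \<not> R n"
    proof -
      from False obtain k where "G k \<noteq> - k"
        by blast
      then have "\<not> R (nat \<bar>k\<bar>)"
        by (cases "k \<ge> 0") (auto simp: R_def)
      then show ?thesis ..
    qed
    then obtain N where N: "\<not> R N" and below: "\<And>n. n < N \<Longrightarrow> R n"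
      using exists_least_iff[of "\<lambda>n. \<not> R n"] by blast
    have "N \<noteq> 0" "N \<noteq> 1"
      using N G1 by (auto simp: R_def intro!: gr0I)
    define m where "m = int N - 1"
    have m: "m \<ge> 1" and Nm: "int N = m + 1"
      using \<open>N \<noteq> 0\<close> \<open>N \<noteq> 1\<close> by (auto simp: m_def)
    have inside: "G k = - k" if "\<bar>k\<bar> \<le> m" for k
      using below[of "nat \<bar>k\<bar>"] that Nm by (cases "k \<ge> 0") (auto simp: R_def)
    have "\<not> (G (m + 1) = - (m + 1) \<and> G (- (m + 1)) = m + 1)"
      using N by (simp add: R_def Nm)
    then have contr: "\<bar>G (G t)\<bar> < \<bar>t\<bar>" if "\<bar>t\<bar> > m" for t
      using broken_reflection_contracts[OF G m _ _ _ that] inside m by simp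
    let ?I = "fence_interval (X (z - m)) (X (z + m))"
    have I: "X (z + k) \<in> ?I \<longleftrightarrow> \<bar>k\<bar> \<le> m" for k
      using m by (auto simp: fence_interval_def image_iff)
    have "X z \<in> ?I"
      using I[of 0] m by simp
    moreover have "has_period f t 2" if "t \<in> ?I - {X z}" for t
    proof -
      obtain k where t: "t = X (z + k)"
        using coord by blast
      then show ?thesis
        using that I[of k] inside[of k] inside[of "- k"] fG[of k] fG[of "- k"]
        by (auto simp: has_period_2_iff)
    qed
    moreover have "\<exists>n>0. (f ^^ n) t \<in> ?I" if "t \<in> UNIV - ?I" for t
    proof -
      obtain k where t: "t = X (z + k)"
        using coord by blast
      then show ?thesis
        using that contracting_orbit_enters[of m G k, OF contr] by (auto simp: fGn I)
    qed
    ultimately have "absorbed_by_period_two_interval f"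
      unfolding absorbed_by_period_two_interval_def using fix_z by blast
    then show ?thesis ..
  qed
  then show ?thesis
    using alternatives_exclusive by blast
qed

end
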